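(* Let $U\subseteq\mathbb{M}\mathbb{C}(n)$ be open, and let $\tau:\mathbb{M}\mathbb{C}(n)\to\mathbb{M}\mathbb{C}(n)$ be the involution determined by $\tau(\mathbf{i}_k)=-\mathbf{i}_k$ for $1\le k\le n$. Let $F:U\to\mathbb{M}\mathbb{C}(n)$ be a function of class $C^1$. Then the following statements are equivalent. (i) $F\in\displaystyle\bigcap_{k=1}^n\overline{\mathrm{Hol}}_{\mathbf{i}_k}(U)$. (ii) $\tau\circ F\in\mathrm{Hol}(U)$. (iii) There exists a function $\mu:U\to\mathbb{M}\mathbb{C}(n)$ such that $DF(\eta)[h]=\mu(\eta)\tau(h)$ for all $\eta\in U$ and $h\in\mathbb{M}\mathbb{C}(n)$. Consequently, $$\bigcap_{k=1}^n\overline{\mathrm{Hol}}_{\mathbf{i}_k}(U)=\{\tau\circ G:G\in\mathrm{Hol}(U)\}.$$ Equivalently, $$\bigcap_{k=1}^n\overline{\mathrm{Hol}}_{\mathbf{i}_k}(U)=\{G\circ\tau:G\in\mathrm{Hol}(\tau(U))\}.$$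
   Context: Let $n\ge1$. The multicomplex numbers are defined recursively by $\mathbb{M}\mathbb{C}(0)=\mathbb{R}$ and $\mathbb{M}\mathbb{C}(n)=\{\eta_1+\eta_2\mathbf{i}_n:\eta_1,\eta_2\in\mathbb{M}\mathbb{C}(n-1)\}$ with $\mathbf{i}_n^2=-1$, where $\mathbf{i}_n$ is a new formal square root of $-1$ commuting with everything. Thus $\mathbb{M}\mathbb{C}(n)$ is a commutative unital real algebra of dimension $2^n$ generated by commuting units $\mathbf{i}_1,\dots,\mathbf{i}_n$ with $\mathbf{i}_k^2=-1$; the $2^n$ monomials $\mathbf{i}_1^{a_1}\cdots\mathbf{i}_n^{a_n}$, $a_k\in\{0,1\}$, form a real basis. An involution of $\mathbb{M}\mathbb{C}(n)$ is a real-linear multiplicative map whose square is the identity. "Class $C^1$" means continuously differentiable as a map between real vector spaces, and $DF(\eta)$ is the real differential at $\eta$. For an open set $V$, $\mathrm{Hol}(V)$ is the set of $C^1$ functions $F:V\to\mathbb{M}\mathbb{C}(n)$ such that for every $\eta\in V$ there is $\lambda(\eta)\in\mathbb{M}\mathbb{C}(n)$ with $DF(\eta)[h]=\lambda(\eta)h$ for all $h\in\mathbb{M}\mathbb{C}(n)$. $\overline{\mathrm{Hol}}_{\mathbf{i}_k}(V)$ is the set of $C^1$ functions $F:V\to\mathbb{M}\mathbb{C}(n)$ with $DF(\eta)\circ\mathcal{L}_{\mathbf{i}_k}=-\mathcal{L}_{\mathbf{i}_k}\circ DF(\eta)$ for every $\eta\in V$, where $\mathcal{L}_{\mathbf{i}_k}(h)=\mathbf{i}_kh$.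 *)

theory Defs
  imports "HOL-Analysis.Analysis"
begin

text \<open>
  The commuting imaginary units are indexed by a finite type \<open>'n\<close>, so that \<open>'n multicomplex\<close> is
  the algebra MC(n) with n = CARD('n).  An element is stored as the family of its real
  coordinates with respect to the monomial basis; the monomial that is the product of the units
  in a set \<open>A\<close> is indexed by \<open>A\<close>.
\<close>

typedef 'n multicomplex = "UNIV :: ('n set \<Rightarrow> real) set"
  morphisms mc_coeff MC ..

lemma mc_coeff_MC [simp]: "mc_coeff (MC f) = f"
  by (simp add: MC_inverse)

lemma multicomplex_eqI: "(\<And>A. mc_coeff x A = mc_coeff y A) \<Longrightarrow> x = y"
  by (metis ext mc_coeff_inject)

lemma multicomplex_eq_iff: "x = y \<longleftrightarrow> (\<forall>A. mc_coeff x A = mc_coeff y A)"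
  by (auto intro: multicomplex_eqI)

text \<open>
  Multiplying the monomials of \<open>A\<close> and \<open>B\<close>, each unit in \<open>A \<inter> B\<close> occurs squared and contributes
  a factor -1, and the monomial of \<open>sym_diff A B\<close> remains.
\<close>

instantiation multicomplex :: (finite) comm_ring_1
begin

definition "0 = MC (\<lambda>A. 0)"
definition "1 = MC (\<lambda>A. if A = {} then 1 else 0)"
definition "x + y = MC (\<lambda>A. mc_coeff x A + mc_coeff y A)"
definition "x - y = MC (\<lambda>A. mc_coeff x A - mc_coeff y A)"
definition "- x = MC (\<lambda>A. - mc_coeff x A)"
definition "x * y = MC (\<lambda>C. \<Sum>(A, B) | sym_diff A B = C.
    (- 1) ^ card (A \<inter> B) * mc_coeff x A * mc_coeff y B)"

lemma mc_coeff_zero [simp]: "mc_coeff 0 A = 0"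
  and mc_coeff_one: "mc_coeff 1 A = (if A = {} then 1 else 0)"
  and mc_coeff_add [simp]: "mc_coeff (x + y) A = mc_coeff x A + mc_coeff y A"
  and mc_coeff_diff [simp]: "mc_coeff (x - y) A = mc_coeff x A - mc_coeff y A"
  and mc_coeff_uminus [simp]: "mc_coeff (- x) A = - mc_coeff x A"
  by (simp_all add: zero_multicomplex_def one_multicomplex_def plus_multicomplex_def
      minus_multicomplex_def uminus_multicomplex_def)

lemma sym_diff_cancel: "sym_diff A (sym_diff A B) = B"
  by blast

lemma mc_coeff_mult:
  "mc_coeff (x * y) C =
    (\<Sum>A\<in>UNIV. (- 1) ^ card (A \<inter> sym_diff A C) * mc_coeff x A * mc_coeff y (sym_diff A C))"
proof -
  have "(\<Sum>(A, B) | sym_diff A B = C. (- 1) ^ card (A \<inter> B) * mc_coeff x A * mc_coeff y B)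
      = (\<Sum>A\<in>UNIV. (- 1) ^ card (A \<inter> sym_diff A C) * mc_coeff x A * mc_coeff y (sym_diff A C))"
  proof -
    have "{(A, B). sym_diff A B = C} = range (\<lambda>A. (A, sym_diff A C))"
      by blast
    moreover have "inj (\<lambda>A. (A, sym_diff A C))"
      by (rule injI) simp
    ultimately show ?thesis
      by (simp only: sum.reindex o_def split_conv)
  qed
  thus ?thesis by (simp add: times_multicomplex_def)
qed

lemma mc_sign_sym_diff:
  fixes A B D :: "'b::finite set"
  shows "(- 1 :: real) ^ card (sym_diff A B \<inter> D) = (- 1) ^ card (A \<inter> D) * (- 1) ^ card (B \<inter> D)"
proof -
  have prod: "(- 1 :: real) ^ card S = (\<Prod>k\<in>UNIV. if k \<in> S then - 1 else 1)" for S :: "'b set"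
    by (simp add: prod.If_cases)
  show ?thesis
    unfolding prod prod.distrib [symmetric] by (rule prod.cong) auto
qed

lemma sum_sym_diff:
  fixes B :: "'b::finite set" and f :: "'b set \<Rightarrow> real"
  shows "(\<Sum>A\<in>UNIV. f (sym_diff A B)) = (\<Sum>A\<in>UNIV. f A)"
proof (rule sum.reindex_bij_witness[of _ "\<lambda>A. sym_diff A B" "\<lambda>A. sym_diff A B"])
  show "sym_diff (sym_diff A B) B = A" for A
    by blast
  then show "sym_diff (sym_diff A B) B = A" for A .
qed simp_all

instance
proof
  fix a b c :: "'a multicomplex"
  show "a * b * c = a * (b * c)"
  proof (rule multicomplex_eqI)
    fix C
    let ?s = "\<lambda>A B :: 'a set. (- 1 :: real) ^ card (A \<inter> B)"
    have s: "?s (sym_diff A B) (sym_diff A (sym_diff B C)) * ?s A B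
        = ?s A (sym_diff A C) * ?s B (sym_diff B (sym_diff A C))" for A B
    proof -
      have sr: "?s A (sym_diff B D) = ?s A B * ?s A D" for A B D
        using mc_sign_sym_diff[of B D A] by (simp add: Int_commute)
      have "?s B A = ?s A B"
        by (simp only: Int_commute)
      moreover have "?s A B * ?s A B = 1"
        by (simp flip: power_add)
      moreover have "a * p * (p * b * (c * d)) * p = a * c * (b * (p * d))"
        if "p * p = 1" for a b c d p :: real
      proof -
        have "a * p * (p * b * (c * d)) * p = (p * p) * (a * c * (b * (p * d)))"
          by (simp only: mult_ac)
        thus ?thesis using that by simp
      qed
      ultimately show ?thesis
        unfolding mc_sign_sym_diff sr by simp
    qed
    have "mc_coeff (a * b * c) C = (\<Sum>E\<in>UNIV. \<Sum>A\<in>UNIV. ?s E (sym_diff E C) * ?s A (sym_diff A E)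
          * mc_coeff a A * mc_coeff b (sym_diff A E) * mc_coeff c (sym_diff E C))"
      by (simp only: mc_coeff_mult sum_distrib_left sum_distrib_right mult_ac)
    also have "\<dots> = (\<Sum>A\<in>UNIV. \<Sum>E\<in>UNIV. ?s E (sym_diff E C) * ?s A (sym_diff A E)
          * mc_coeff a A * mc_coeff b (sym_diff A E) * mc_coeff c (sym_diff E C))"
      by (rule sum.swap)
    also have "\<dots> = (\<Sum>A\<in>UNIV. \<Sum>B\<in>UNIV. ?s A (sym_diff A C) * ?s B (sym_diff B (sym_diff A C))
          * mc_coeff a A * mc_coeff b B * mc_coeff c (sym_diff B (sym_diff A C)))"
    proof (rule sum.cong[OF refl])
      fix A :: "'a set"
      have e: "sym_diff A (sym_diff A B) = B"
        "sym_diff (sym_diff A B) C = sym_diff A (sym_diff B C)"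
        "sym_diff B (sym_diff A C) = sym_diff A (sym_diff B C)"
        "sym_diff B A = sym_diff A B" for B
        by auto
      have "(\<Sum>E\<in>UNIV. ?s E (sym_diff E C) * ?s A (sym_diff A E)
            * mc_coeff a A * mc_coeff b (sym_diff A E) * mc_coeff c (sym_diff E C))
          = (\<Sum>B\<in>UNIV. ?s (sym_diff B A) (sym_diff (sym_diff B A) C) * ?s A (sym_diff A (sym_diff B A))
            * mc_coeff a A * mc_coeff b (sym_diff A (sym_diff B A))
            * mc_coeff c (sym_diff (sym_diff B A) C))"
        by (rule sum_sym_diff [symmetric])
      also have "\<dots> = (\<Sum>B\<in>UNIV. ?s A (sym_diff A C) * ?s B (sym_diff B (sym_diff A C))
          * mc_coeff a A * mc_coeff b B * mc_coeff c (sym_diff B (sym_diff A C)))"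
        unfolding s[symmetric] unfolding e(4) unfolding e(1,2,3) ..
      finally show "(\<Sum>E\<in>UNIV. ?s E (sym_diff E C) * ?s A (sym_diff A E)
            * mc_coeff a A * mc_coeff b (sym_diff A E) * mc_coeff c (sym_diff E C)) = \<dots>" .
    qed
    also have "\<dots> = mc_coeff (a * (b * c)) C"
      by (simp only: mc_coeff_mult sum_distrib_left sum_distrib_right mult_ac)
    finally show "mc_coeff (a * b * c) C = mc_coeff (a * (b * c)) C" .
  qed
  show "a * b = b * a"
    unfolding times_multicomplex_def
    by (rule arg_cong[where f = MC], rule ext,
        rule sum.reindex_bij_witness[of _ prod.swap prod.swap])
       (auto simp: Int_commute mult_ac)
  show "1 * a = a"
  proof (rule multicomplex_eqI)
    fix C
    have "mc_coeff (1 * a) C = (\<Sum>A::'a set\<in>UNIV. if A = {} then mc_coeff a C else 0)"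
      unfolding mc_coeff_mult by (rule sum.cong) (auto simp: mc_coeff_one)
    thus "mc_coeff (1 * a) C = mc_coeff a C"
      by simp
  qed
  show "(a + b) * c = a * c + b * c"
    by (rule multicomplex_eqI)
       (simp only: mc_coeff_mult mc_coeff_add distrib_left distrib_right sum.distrib)
  show "(0 :: 'a multicomplex) \<noteq> 1"
    by (auto simp: multicomplex_eq_iff mc_coeff_one intro!: exI[of _ "{}"])
qed (simp_all add: multicomplex_eq_iff algebra_simps)

end

instantiation multicomplex :: (finite) real_algebra_1
begin

definition "r *\<^sub>R x = MC (\<lambda>A. r * mc_coeff x A)"

lemma mc_coeff_scaleR [simp]: "mc_coeff (r *\<^sub>R x) A = r * mc_coeff x A"
  by (simp add: scaleR_multicomplex_def)

instance
proof
  fix r s :: real and x y :: "'a multicomplex"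
  show "r *\<^sub>R x * y = r *\<^sub>R (x * y)" "x * r *\<^sub>R y = r *\<^sub>R (x * y)"
    by (rule multicomplex_eqI,
        simp only: mc_coeff_mult mc_coeff_scaleR sum_distrib_left mult_ac[where 'a = real])+
qed (simp_all add: multicomplex_eq_iff algebra_simps)

end

text \<open>
  The topology is the Euclidean one in monomial coordinates.  The norm is not submultiplicative,
  so \<open>'n multicomplex\<close> is deliberately not an instance of \<^class>\<open>real_normed_algebra\<close>.
\<close>

instantiation multicomplex :: (finite) real_inner
begin

definition "inner x y = (\<Sum>A\<in>UNIV. mc_coeff x A * mc_coeff y A)"
definition "norm x = sqrt (inner x (x :: 'a multicomplex))"
definition "sgn x = x /\<^sub>R norm (x :: 'a multicomplex)"
definition "dist x y = norm (x - y :: 'a multicomplex)"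
definition "(uniformity :: ('a multicomplex \<times> 'a multicomplex) filter) =
  (INF e\<in>{0 <..}. principal {(x, y). dist x y < e})"
definition "open (U :: 'a multicomplex set) \<longleftrightarrow>
  (\<forall>x\<in>U. eventually (\<lambda>(x', y). x' = x \<longrightarrow> y \<in> U) uniformity)"

instance
proof
  fix x y z :: "'a multicomplex" and r :: real
  show "inner x y = inner y x"
    by (simp add: inner_multicomplex_def mult.commute)
  show "inner (x + y) z = inner x z + inner y z"
    by (simp add: inner_multicomplex_def algebra_simps sum.distrib)
  show "inner (r *\<^sub>R x) y = r * inner x y"
    by (simp add: inner_multicomplex_def sum_distrib_left mult.assoc)
  show "0 \<le> inner x x"
    by (simp add: inner_multicomplex_def sum_nonneg)
  show "inner x x = 0 \<longleftrightarrow> x = 0"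
    by (simp add: inner_multicomplex_def sum_nonneg_eq_0_iff multicomplex_eq_iff)
qed (simp_all add: multicomplex_eq_iff algebra_simps norm_multicomplex_def sgn_multicomplex_def
      dist_multicomplex_def uniformity_multicomplex_def open_multicomplex_def)

end

instantiation multicomplex :: (finite) euclidean_space
begin

definition "Basis = range (\<lambda>A. MC (\<lambda>B. if B = A then 1 else 0) :: 'a multicomplex)"

lemma inner_monomial: "inner x (MC (\<lambda>B. if B = A then 1 else 0)) = mc_coeff x A"
  for x :: "'a multicomplex"
proof -
  have "inner x (MC (\<lambda>B. if B = A then 1 else 0)) = (\<Sum>B\<in>UNIV. if B = A then mc_coeff x A else 0)"
    unfolding inner_multicomplex_def by (rule sum.cong) auto
  thus ?thesis by simp
qed

instance
proof
  fix u v x :: "'a multicomplex"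
  show "(Basis :: 'a multicomplex set) \<noteq> {}" "finite (Basis :: 'a multicomplex set)"
    by (simp_all add: Basis_multicomplex_def)
  show "inner u v = (if u = v then 1 else 0)" if "u \<in> Basis" "v \<in> Basis"
    using that by (auto simp: Basis_multicomplex_def inner_monomial)
  show "(\<forall>u\<in>Basis. inner x u = 0) \<longleftrightarrow> x = 0"
    by (auto simp: Basis_multicomplex_def inner_monomial multicomplex_eq_iff)
qed

end

definition mc_unit :: "'n \<Rightarrow> 'n multicomplex"
  where "mc_unit k = MC (\<lambda>A. if A = {k} then 1 else 0)"

lemma mc_coeff_mult_unit:
  "mc_coeff (x * mc_unit k) C = (if k \<in> C then mc_coeff x (C - {k}) else - mc_coeff x (insert k C))"
  for k :: "'n::finite"
proof -
  have sd: "sym_diff A C = {k} \<longleftrightarrow> A = sym_diff C {k}" for A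
    by auto
  have "mc_coeff (x * mc_unit k) C = (- 1) ^ card (sym_diff C {k} \<inter> {k}) * mc_coeff x (sym_diff C {k})"
  proof -
    have "mc_coeff (x * mc_unit k) C = (\<Sum>A\<in>UNIV. if A = sym_diff C {k}
        then (- 1) ^ card (sym_diff C {k} \<inter> {k}) * mc_coeff x (sym_diff C {k}) else 0)"
      unfolding mc_coeff_mult
    proof (rule sum.cong[OF refl])
      fix A
      show "(- 1) ^ card (A \<inter> sym_diff A C) * mc_coeff x A * mc_coeff (mc_unit k) (sym_diff A C)
        = (if A = sym_diff C {k}
           then (- 1) ^ card (sym_diff C {k} \<inter> {k}) * mc_coeff x (sym_diff C {k}) else 0)"
      proof (cases "sym_diff A C = {k}")
        case True
        with sd[of A] show ?thesis by (simp only: mc_unit_def mc_coeff_MC) simp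
      next
        case False
        with sd[of A] show ?thesis by (simp only: mc_unit_def mc_coeff_MC) simp
      qed
    qed
    thus ?thesis by simp
  qed
  thus ?thesis
    by (auto simp: insert_absorb Int_insert_right)
qed

lemma mc_unit_square: "mc_unit k * mc_unit k = - 1" for k :: "'n::finite"
  by (auto simp: multicomplex_eq_iff mc_coeff_mult_unit) (auto simp: mc_unit_def mc_coeff_one)

lemma prod_mc_unit: "(\<Prod>k\<in>A. mc_unit k) = MC (\<lambda>B. if B = A then 1 else 0)" for A :: "'n::finite set"
proof -
  have "finite A" by simp
  thus ?thesis
    by (induction A)
       (auto simp: multicomplex_eq_iff mc_coeff_one mult.commute[of "mc_unit _"] mc_coeff_mult_unit)
qed

lemma Basis_multicomplex: "(Basis :: 'n::finite multicomplex set) = range (\<lambda>A. \<Prod>k\<in>A. mc_unit k)"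
  by (simp add: Basis_multicomplex_def prod_mc_unit)

lemma DIM_multicomplex: "DIM('n::finite multicomplex) = 2 ^ CARD('n)"
proof -
  have "inj (\<lambda>A. MC (\<lambda>B. if B = A then 1 else 0) :: 'n multicomplex)"
    by (rule injI) (auto simp: multicomplex_eq_iff split: if_splits)
  hence "DIM('n multicomplex) = card (Pow (UNIV :: 'n set))"
    by (simp add: Basis_multicomplex_def card_image)
  thus ?thesis
    by (simp only: card_Pow finite)
qed

text \<open>
  The recursive construction MC(0) = R, MC(m) = MC(m-1) + MC(m-1) i_m is recovered inside
  \<open>'n multicomplex\<close>: \<open>mc_sub K\<close> is the copy of MC(card K) that uses only the units in \<open>K\<close>.
\<close>

definition mc_sub :: "'n set \<Rightarrow> 'n multicomplex set"
  where "mc_sub K = {x. \<forall>A. \<not> A \<subseteq> K \<longrightarrow> mc_coeff x A = 0}"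

lemma mc_sub_empty: "mc_sub {} = (range of_real :: 'n::finite multicomplex set)"
proof (intro equalityI subsetI)
  fix x :: "'n multicomplex" assume "x \<in> mc_sub {}"
  hence "x = of_real (mc_coeff x {})"
    by (auto simp: multicomplex_eq_iff of_real_def mc_coeff_one mc_sub_def)
  thus "x \<in> range of_real" by blast
qed (auto simp: of_real_def mc_coeff_one mc_sub_def split: if_splits)

lemma mc_sub_insert:
  fixes k :: "'n::finite"
  assumes "k \<notin> K"
  shows "bij_betw (\<lambda>(x, y). x + y * mc_unit k) (mc_sub K \<times> mc_sub K) (mc_sub (insert k K))"
proof (rule bij_betw_byWitness[where f' = "\<lambda>z. (MC (\<lambda>A. if k \<in> A then 0 else mc_coeff z A),
    MC (\<lambda>A. if k \<in> A then 0 else mc_coeff z (insert k A)))"])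
  have nk: "mc_coeff x A = 0" if "x \<in> mc_sub K" "k \<in> A" for x A
    using that assms by (auto simp: mc_sub_def)
  show "\<forall>p\<in>mc_sub K \<times> mc_sub K. (\<lambda>z. (MC (\<lambda>A. if k \<in> A then 0 else mc_coeff z A),
      MC (\<lambda>A. if k \<in> A then 0 else mc_coeff z (insert k A)))) ((\<lambda>(x, y). x + y * mc_unit k) p) = p"
    by (auto simp: multicomplex_eq_iff mc_coeff_mult_unit nk)
  show "\<forall>z\<in>mc_sub (insert k K). (\<lambda>(x, y). x + y * mc_unit k)
      ((\<lambda>z. (MC (\<lambda>A. if k \<in> A then 0 else mc_coeff z A),
      MC (\<lambda>A. if k \<in> A then 0 else mc_coeff z (insert k A)))) z) = z"
    by (auto simp: multicomplex_eq_iff mc_coeff_mult_unit insert_absorb)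
  show "(\<lambda>(x, y). x + y * mc_unit k) ` (mc_sub K \<times> mc_sub K) \<subseteq> mc_sub (insert k K)"
  proof clarify
    fix x y assume xy: "x \<in> mc_sub K" "y \<in> mc_sub K"
    have "mc_coeff (x + y * mc_unit k) A = 0" if "\<not> A \<subseteq> insert k K" for A
    proof -
      have "\<not> A \<subseteq> K" "\<not> A - {k} \<subseteq> K" "\<not> insert k A \<subseteq> K"
        using that by blast+
      thus ?thesis using xy by (simp add: mc_sub_def mc_coeff_mult_unit)
    qed
    thus "x + y * mc_unit k \<in> mc_sub (insert k K)"
      by (simp add: mc_sub_def)
  qed
  show "(\<lambda>z. (MC (\<lambda>A. if k \<in> A then 0 else mc_coeff z A),
      MC (\<lambda>A. if k \<in> A then 0 else mc_coeff z (insert k A)))) ` mc_sub (insert k K)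
      \<subseteq> mc_sub K \<times> mc_sub K"
  proof clarify
    fix z assume z: "z \<in> mc_sub (insert k K)"
    have "mc_coeff z A = 0 \<and> mc_coeff z (insert k A) = 0" if "\<not> A \<subseteq> K" "k \<notin> A" for A
    proof -
      have "\<not> A \<subseteq> insert k K" "\<not> insert k A \<subseteq> insert k K"
        using that by blast+
      thus ?thesis using z by (simp add: mc_sub_def)
    qed
    thus "MC (\<lambda>A. if k \<in> A then 0 else mc_coeff z A) \<in> mc_sub K \<and>
        MC (\<lambda>A. if k \<in> A then 0 else mc_coeff z (insert k A)) \<in> mc_sub K"
      by (simp add: mc_sub_def)
  qed
qed

lemma mc_sub_UNIV: "mc_sub UNIV = UNIV"
  by (simp add: mc_sub_def)

definition mc_involution :: "('n::finite multicomplex \<Rightarrow> 'n multicomplex) \<Rightarrow> bool"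
  where "mc_involution f \<longleftrightarrow> linear f \<and> (\<forall>x y. f (x * y) = f x * f y) \<and> f \<circ> f = id"

lemma ex1_conjugation:
  "\<exists>!\<tau>. mc_involution \<tau> \<and> (\<forall>k::'n::finite. \<tau> (mc_unit k) = - mc_unit k)"
proof (rule ex_ex1I)
  define c :: "'n multicomplex \<Rightarrow> 'n multicomplex"
    where "c x = MC (\<lambda>A. (- 1) ^ card A * mc_coeff x A)" for x
  have sd: "(- 1 :: real) ^ card C = (- 1) ^ card A * (- 1) ^ card (sym_diff A C)" for A C :: "'n set"
    using mc_sign_sym_diff[of A "sym_diff A C" UNIV]
    unfolding sym_diff_cancel by simp
  have "linear c"
    by (rule linearI) (auto simp: c_def multicomplex_eq_iff algebra_simps)
  moreover have "c (x * y) = c x * c y" for x y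
  proof (rule multicomplex_eqI)
    fix C
    have "mc_coeff (c (x * y)) C = (\<Sum>A\<in>UNIV. (- 1) ^ card C *
        ((- 1) ^ card (A \<inter> sym_diff A C) * mc_coeff x A * mc_coeff y (sym_diff A C)))"
      by (simp only: c_def mc_coeff_MC mc_coeff_mult sum_distrib_left)
    also have "\<dots> = mc_coeff (c x * c y) C"
      unfolding mc_coeff_mult c_def mc_coeff_MC
    proof (rule sum.cong[OF refl])
      fix A
      show "(- 1) ^ card C * ((- 1) ^ card (A \<inter> sym_diff A C) * mc_coeff x A * mc_coeff y (sym_diff A C))
        = (- 1) ^ card (A \<inter> sym_diff A C) * ((- 1) ^ card A * mc_coeff x A) *
          ((- 1) ^ card (sym_diff A C) * mc_coeff y (sym_diff A C))"
        unfolding sd[of C A] by (simp only: mult_ac)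
    qed
    finally show "mc_coeff (c (x * y)) C = mc_coeff (c x * c y) C" .
  qed
  moreover have "c \<circ> c = id"
    by (rule ext) (simp add: c_def multicomplex_eq_iff mult.assoc [symmetric] power_add [symmetric])
  moreover have "c (mc_unit k) = - mc_unit k" for k
    by (simp add: c_def multicomplex_eq_iff mc_unit_def)
  ultimately show "\<exists>\<tau>. mc_involution \<tau> \<and> (\<forall>k::'n. \<tau> (mc_unit k) = - mc_unit k)"
    unfolding mc_involution_def by blast
next
  fix f g :: "'n multicomplex \<Rightarrow> 'n multicomplex"
  assume f: "mc_involution f \<and> (\<forall>k. f (mc_unit k) = - mc_unit k)"
    and g: "mc_involution g \<and> (\<forall>k. g (mc_unit k) = - mc_unit k)"
  have mono: "h (\<Prod>k\<in>A. mc_unit k) = (\<Prod>k\<in>A. - mc_unit k)"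
    if h: "mc_involution h \<and> (\<forall>k. h (mc_unit k) = - mc_unit k)" for h and A :: "'n set"
  proof -
    have hh: "h (h x) = x" and hm: "h (x * y) = h x * h y" for x y
      using h unfolding mc_involution_def by (auto dest: fun_cong)
    have one: "h 1 = 1"
      by (metis hh hm mult.left_neutral mult.right_neutral)
    have "finite A" by simp
    thus ?thesis by (induction A) (use h one hm in auto)
  qed
  show "f = g"
  proof (rule ext, rule linear_eq_on_span[of f g Basis])
    show "f x = g x" if "x \<in> Basis" for x
      using that mono[OF f] mono[OF g] unfolding Basis_multicomplex by auto
  qed (use f g in \<open>auto simp: mc_involution_def\<close>)
qed

text \<open>
  Functions on \<open>V\<close> are total functions whose values outside \<open>V\<close> are irrelevant: for open \<open>V\<close>
  the conditions below depend only on the restriction to \<open>V\<close>.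
\<close>

definition C1_on :: "'a::real_normed_vector set \<Rightarrow> ('a \<Rightarrow> 'b::real_normed_vector) \<Rightarrow> bool"
  where "C1_on V F \<longleftrightarrow> (\<exists>F' :: 'a \<Rightarrow> ('a \<Rightarrow>\<^sub>L 'b).
    (\<forall>\<eta>\<in>V. (F has_derivative blinfun_apply (F' \<eta>)) (at \<eta>)) \<and> continuous_on V F')"

abbreviation DF :: "('a::real_normed_vector \<Rightarrow> 'b::real_normed_vector) \<Rightarrow> 'a \<Rightarrow> 'a \<Rightarrow> 'b"
  where "DF F \<eta> \<equiv> frechet_derivative F (at \<eta>)"

definition Hol :: "'n::finite multicomplex set \<Rightarrow> ('n multicomplex \<Rightarrow> 'n multicomplex) set"
  where "Hol V = {F. C1_on V F \<and> (\<forall>\<eta>\<in>V. \<exists>l. \<forall>h. DF F \<eta> h = l * h)}"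

definition Hol_bar :: "'n::finite \<Rightarrow> 'n multicomplex set \<Rightarrow> ('n multicomplex \<Rightarrow> 'n multicomplex) set"
  where "Hol_bar k V = {F. C1_on V F \<and>
    (\<forall>\<eta>\<in>V. DF F \<eta> \<circ> (\<lambda>h. mc_unit k * h) = (\<lambda>h. - (mc_unit k * DF F \<eta> h)))}"

end

theory Submission
  imports Defs
begin

text \<open>
  Everything reduces to one fact about a single real-linear map \<open>D\<close>: it anticommutes with
  multiplication by each unit if and only if it has the form \<open>h \<mapsto> m * \<tau> h\<close>.  An anticommuting
  \<open>D\<close> is determined by \<open>m = D 1\<close>, since moving the units of a monomial out of the argument one at a
  time costs one sign per unit, which is precisely the sign that \<open>\<tau>\<close> gives to the monomial; and the
  monomials span (lemma \<open>anticommutes_units_iff\<close>).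

  Since \<open>\<tau>\<close> is a multiplicative involution, composing with it on either side turns the maps
  \<open>h \<mapsto> m * \<tau> h\<close> into the multiplications \<open>h \<mapsto> l * h\<close> and back.  Being linear, \<open>\<tau>\<close> is its own
  differential, so by the chain rule this applies pointwise to differentials: a function \<open>F\<close> is in
  all the classes \<open>Hol_bar k U\<close> exactly when \<open>\<tau> \<circ> F \<in> Hol U\<close>, and exactly when
  \<open>F \<circ> \<tau> \<in> Hol (\<tau> ` U)\<close>.  The two descriptions of the intersection follow because composing twice
  with \<open>\<tau>\<close> gives back the original function.
\<close>

lemma C1_on_has_derivative:
  assumes "C1_on V F" "\<eta> \<in> V"
  shows "(F has_derivative DF F \<eta>) (at \<eta>)"
  using assms unfolding C1_on_def by (metis frechet_derivative_at)

lemma C1_on_linear_comp: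
  assumes L: "bounded_linear L" and F: "C1_on V F"
  shows "C1_on V (L \<circ> F)"
proof -
  obtain F' where F': "\<And>\<eta>. \<eta> \<in> V \<Longrightarrow> (F has_derivative blinfun_apply (F' \<eta>)) (at \<eta>)"
    and cont: "continuous_on V F'"
    using F unfolding C1_on_def by blast
  have "((L \<circ> F) has_derivative blinfun_apply (Blinfun L o\<^sub>L F' \<eta>)) (at \<eta>)" if "\<eta> \<in> V" for \<eta>
    using bounded_linear.has_derivative[OF L F'[OF that]]
    by (simp add: o_def blinfun_compose.rep_eq bounded_linear_Blinfun_apply[OF L])
  moreover have "continuous_on V (\<lambda>\<eta>. Blinfun L o\<^sub>L F' \<eta>)"
    by (intro continuous_intros cont)
  ultimately show ?thesis
    unfolding C1_on_def by (intro exI[of _ "\<lambda>\<eta>. Blinfun L o\<^sub>L F' \<eta>"]) simp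
qed

lemma C1_on_comp_linear:
  assumes L: "bounded_linear L" and F: "C1_on (L ` V) F"
  shows "C1_on V (F \<circ> L)"
proof -
  obtain F' where F': "\<And>\<eta>. \<eta> \<in> L ` V \<Longrightarrow> (F has_derivative blinfun_apply (F' \<eta>)) (at \<eta>)"
    and cont: "continuous_on (L ` V) F'"
    using F unfolding C1_on_def by blast
  have "((F \<circ> L) has_derivative blinfun_apply (F' (L \<eta>) o\<^sub>L Blinfun L)) (at \<eta>)" if "\<eta> \<in> V" for \<eta>
    using diff_chain_at[OF bounded_linear_imp_has_derivative[OF L] F'[OF imageI[OF that]]]
    by (simp add: o_def blinfun_compose.rep_eq bounded_linear_Blinfun_apply[OF L])
  moreover have "continuous_on V (\<lambda>\<eta>. F' (L \<eta>) o\<^sub>L Blinfun L)"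
    by (intro continuous_intros continuous_on_compose2[OF cont]
          linear_continuous_on[OF L]) auto
  ultimately show ?thesis
    unfolding C1_on_def by (intro exI[of _ "\<lambda>\<eta>. F' (L \<eta>) o\<^sub>L Blinfun L"]) simp
qed

lemma DF_linear_comp:
  assumes "bounded_linear L" "C1_on V F" "\<eta> \<in> V"
  shows "DF (L \<circ> F) \<eta> h = L (DF F \<eta> h)"
proof -
  have "((L \<circ> F) has_derivative (\<lambda>h. L (DF F \<eta> h))) (at \<eta>)"
    using bounded_linear.has_derivative[OF assms(1) C1_on_has_derivative[OF assms(2,3)]]
    by (simp only: o_def)
  from fun_cong[OF frechet_derivative_at[OF this], of h] show ?thesis by (rule sym)
qed

lemma DF_comp_linear:
  assumes "bounded_linear L" "C1_on (L ` V) F" "\<eta> \<in> V"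
  shows "DF (F \<circ> L) \<eta> h = DF F (L \<eta>) (L h)"
proof -
  have "((F \<circ> L) has_derivative DF F (L \<eta>) \<circ> L) (at \<eta>)"
    using assms by (intro diff_chain_at bounded_linear_imp_has_derivative C1_on_has_derivative) auto
  from fun_cong[OF frechet_derivative_at[OF this], of h] show ?thesis by simp
qed

context
  fixes \<tau> :: "'n::finite multicomplex \<Rightarrow> 'n multicomplex"
  assumes inv: "mc_involution \<tau>" and units: "\<And>k. \<tau> (mc_unit k) = - mc_unit k"
begin

lemma conj_linear: "linear \<tau>"
  and conj_mult: "\<tau> (x * y) = \<tau> x * \<tau> y"
  and conj_conj [simp]: "\<tau> (\<tau> x) = x"
  using inv unfolding mc_involution_def by (auto dest: fun_cong)

lemma conj_bounded_linear: "bounded_linear \<tau>"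
  by (simp add: conj_linear linear_conv_bounded_linear [symmetric])

lemma conj_one: "\<tau> 1 = 1"
  by (metis conj_conj conj_mult mult_1_left mult_1_right)

lemma conj_comp_conj: "\<tau> \<circ> (\<tau> \<circ> F) = F" "G \<circ> \<tau> \<circ> \<tau> = G" "\<tau> ` \<tau> ` V = V"
  by (auto simp: fun_eq_iff image_image)

text \<open>
  The linear algebra behind all the equivalences.  In the forward direction the multiplier must be
  \<open>D 1\<close>, and agreement with \<open>h \<mapsto> D 1 * \<tau> h\<close> is checked on monomials by induction on the set of
  units; in the converse direction the sign comes from \<open>\<tau> (mc_unit k) = - mc_unit k\<close>.
\<close>

lemma anticommutes_units_iff:
  assumes D: "linear D"
  shows "(\<forall>k. D \<circ> (\<lambda>h. mc_unit k * h) = (\<lambda>h. - (mc_unit k * D h))) \<longleftrightarrow>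
    (\<exists>m. \<forall>h. D h = m * \<tau> h)"
proof
  assume "\<forall>k. D \<circ> (\<lambda>h. mc_unit k * h) = (\<lambda>h. - (mc_unit k * D h))"
  then have anti: "D (mc_unit k * h) = - (mc_unit k * D h)" for k h
    by (metis comp_apply)
  have monomial: "D (\<Prod>k\<in>A. mc_unit k) = D 1 * \<tau> (\<Prod>k\<in>A. mc_unit k)" for A
  proof -
    have "finite A" by simp
    then show ?thesis
      by (induction A) (auto simp: conj_one conj_mult anti units mult_ac)
  qed
  have "D h = D 1 * \<tau> h" for h
  proof (rule linear_eq_on_span[of D "\<lambda>h. D 1 * \<tau> h" Basis])
    show "linear (\<lambda>h. D 1 * \<tau> h)"
      by (rule linearI) (simp_all add: linear_add[OF conj_linear] linear_scale[OF conj_linear]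
          distrib_left)
    show "D b = D 1 * \<tau> b" if "b \<in> Basis" for b
      using that monomial by (auto simp: Basis_multicomplex)
  qed (use D in simp_all)
  then show "\<exists>m. \<forall>h. D h = m * \<tau> h" by blast
next
  assume "\<exists>m. \<forall>h. D h = m * \<tau> h"
  then show "\<forall>k. D \<circ> (\<lambda>h. mc_unit k * h) = (\<lambda>h. - (mc_unit k * D h))"
    by (auto simp: fun_eq_iff conj_mult units mult_ac)
qed

lemma conj_comp_multiplication_iff:
  "(\<exists>l. \<forall>h. \<tau> (D h) = l * h) \<longleftrightarrow> (\<exists>m. \<forall>h. D h = m * \<tau> h)"
  by (metis conj_conj conj_mult)

lemma comp_conj_multiplication_iff:
  "(\<exists>l. \<forall>h. D (\<tau> h) = l * h) \<longleftrightarrow> (\<exists>m. \<forall>h. D h = m * \<tau> h)"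
  by (metis conj_conj)

lemma Inter_Hol_bar_iff:
  "F \<in> (\<Inter>k. Hol_bar k V) \<longleftrightarrow> C1_on V F \<and> (\<forall>\<eta>\<in>V. \<exists>m. \<forall>h. DF F \<eta> h = m * \<tau> h)"
proof (cases "C1_on V F")
  case True
  have "linear (DF F \<eta>)" if "\<eta> \<in> V" for \<eta>
    by (rule has_derivative_linear[OF C1_on_has_derivative[OF True that]])
  then show ?thesis
    using True by (auto simp: Hol_bar_def simp flip: anticommutes_units_iff)
qed (simp add: Hol_bar_def)

lemma C1_on_conj_comp_iff: "C1_on V (\<tau> \<circ> F) \<longleftrightarrow> C1_on V F"
  using C1_on_linear_comp[OF conj_bounded_linear, of V F]
    C1_on_linear_comp[OF conj_bounded_linear, of V "\<tau> \<circ> F"]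
  unfolding conj_comp_conj by blast

lemma C1_on_comp_conj_iff: "C1_on (\<tau> ` V) (F \<circ> \<tau>) \<longleftrightarrow> C1_on V F"
  using C1_on_comp_linear[OF conj_bounded_linear, of "\<tau> ` V" F]
    C1_on_comp_linear[OF conj_bounded_linear, of V "F \<circ> \<tau>"]
  unfolding conj_comp_conj by blast

lemma conj_comp_in_Hol_iff: "\<tau> \<circ> F \<in> Hol V \<longleftrightarrow> F \<in> (\<Inter>k. Hol_bar k V)"
  unfolding Inter_Hol_bar_iff Hol_def mem_Collect_eq C1_on_conj_comp_iff
  by (auto simp: DF_linear_comp[OF conj_bounded_linear] simp flip: conj_comp_multiplication_iff)

lemma comp_conj_in_Hol_iff: "F \<circ> \<tau> \<in> Hol (\<tau> ` V) \<longleftrightarrow> F \<in> (\<Inter>k. Hol_bar k V)"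
proof -
  have "DF (F \<circ> \<tau>) (\<tau> \<eta>) h = DF F \<eta> (\<tau> h)" if "C1_on V F" "\<eta> \<in> V" for \<eta> h
    using DF_comp_linear[OF conj_bounded_linear, of "\<tau> ` V" F "\<tau> \<eta>" h] that
    by (simp add: conj_comp_conj(3))
  then show ?thesis
    unfolding Inter_Hol_bar_iff Hol_def mem_Collect_eq C1_on_comp_conj_iff
    by (auto simp flip: comp_conj_multiplication_iff)
qed

end

theorem proposition4p12:
  fixes U :: "'n::finite multicomplex set"
    and \<tau> :: "'n multicomplex \<Rightarrow> 'n multicomplex"
  assumes "open U"
    and "mc_involution \<tau>"
    and "\<And>k. \<tau> (mc_unit k) = - mc_unit k"
  shows "(\<forall>F. C1_on U F \<longrightarrow>
            (F \<in> (\<Inter>k. Hol_bar k U) \<longleftrightarrow> \<tau> \<circ> F \<in> Hol U) \<and>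
            (\<tau> \<circ> F \<in> Hol U \<longleftrightarrow> (\<exists>\<mu>. \<forall>\<eta>\<in>U. \<forall>h. DF F \<eta> h = \<mu> \<eta> * \<tau> h))) \<and>
         (\<Inter>k. Hol_bar k U) = {\<tau> \<circ> G | G. G \<in> Hol U} \<and>
         (\<Inter>k. Hol_bar k U) = {G \<circ> \<tau> | G. G \<in> Hol (\<tau> ` U)}"
proof (intro conjI allI impI)
  note conj = assms(2,3)
  note Inter_iff = Inter_Hol_bar_iff[OF conj]
  note left_iff = conj_comp_in_Hol_iff[OF conj]
  note right_iff = comp_conj_in_Hol_iff[OF conj]
  note cancel = conj_comp_conj[OF conj]
  show "F \<in> (\<Inter>k. Hol_bar k U) \<longleftrightarrow> \<tau> \<circ> F \<in> Hol U" for F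
    by (simp only: left_iff)
  show "\<tau> \<circ> F \<in> Hol U \<longleftrightarrow> (\<exists>\<mu>. \<forall>\<eta>\<in>U. \<forall>h. DF F \<eta> h = \<mu> \<eta> * \<tau> h)" if "C1_on U F" for F
    unfolding left_iff Inter_iff bchoice_iff using that by simp
  show "(\<Inter>k. Hol_bar k U) = {\<tau> \<circ> G | G. G \<in> Hol U}"
  proof (intro equalityI subsetI)
    fix F assume "F \<in> (\<Inter>k. Hol_bar k U)"
    then have "\<tau> \<circ> F \<in> Hol U" by (simp only: left_iff)
    then show "F \<in> {\<tau> \<circ> G | G. G \<in> Hol U}"
      using cancel(1)[of F] by (intro CollectI exI[of _ "\<tau> \<circ> F"]) simp
  next
    fix F assume "F \<in> {\<tau> \<circ> G | G. G \<in> Hol U}"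
    then have "\<tau> \<circ> F \<in> Hol U" by (auto simp only: mem_Collect_eq cancel(1))
    then show "F \<in> (\<Inter>k. Hol_bar k U)" by (simp only: left_iff)
  qed
  show "(\<Inter>k. Hol_bar k U) = {G \<circ> \<tau> | G. G \<in> Hol (\<tau> ` U)}"
  proof (intro equalityI subsetI)
    fix F assume "F \<in> (\<Inter>k. Hol_bar k U)"
    then have "F \<circ> \<tau> \<in> Hol (\<tau> ` U)" by (simp only: right_iff)
    then show "F \<in> {G \<circ> \<tau> | G. G \<in> Hol (\<tau> ` U)}"
      using cancel(2)[of F] by (intro CollectI exI[of _ "F \<circ> \<tau>"]) simp
  next
    fix F assume "F \<in> {G \<circ> \<tau> | G. G \<in> Hol (\<tau> ` U)}"
    then have "F \<circ> \<tau> \<in> Hol (\<tau> ` U)" by (auto simp only: mem_Collect_eq cancel(2))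
    then show "F \<in> (\<Inter>k. Hol_bar k U)" by (simp only: right_iff)
  qed
qed

end
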